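(* Let $P,Q$ be cones and $n\in\mathbb N$. A function $f:\mathcal B P\to Q$ is $n$-non-decreasing from $P$ to $Q$ if and only if it is $n$-pre-stable from $P$ to $Q$. Consequently $f$ is absolutely monotonic iff it is pre-stable.
   Context: A cone is an $\mathbb R_{\ge0}$-semimodule $P$ with $\|\cdot\|_P:P\to\mathbb R_{\ge0}$ such that for all $x,x',y,y'$ and $\alpha\ge0$: $x+y=x+y'\Rightarrow y=y'$; $\|\alpha x\|=\alpha\|x\|$; $\|x\|=0\Rightarrow x=0$; $\|x+x'\|\le\|x\|+\|x'\|$; $\|x\|\le\|x+x'\|$. $\mathcal B P=\{x:\|x\|_P\le1\}$. Cone order: $x\le_P x'$ iff $x'=x+y$ for some $y$ (unique, written $x'-x$). For $u\in\mathcal B P$, the local cone $P_u$ has carrier $\{x\in P:\exists\epsilon>0,\ \epsilon x+u\in\mathcal B P\}$, the operations of $P$, and norm $\inf\{1/\epsilon:\epsilon>0,\ \epsilon x+u\in\mathcal B P\}$; its unit ball is $\{x:x+u\in\mathcal B P\}$. For a finite sequence $\vec u$ with $\sum u_i\in\mathcal B P$, $P_{\vec u}=P_{\sum_iu_i}$. A function $f:\mathcal B P\to Q$ is $0$-non-decreasing if it is non-decreasing; for $n>0$ it is $n$-non-decreasing if it is non-decreasing and for every $u\in\mathcal B P$ the function $x\mapsto f(x+u)-f(x)$ (defined for $x\in\mathcal B(P_u)$) is $(n-1)$-non-decreasing from $P_u$ to $Q$. $f$ is absolutely monotonic if it is $n$-non-decreasing for all $n$. For $\vec u\in P^k$, $x$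 with $x+\sum u_i\in\mathcal B P$, and $\epsilon\in\{+,-\}$, $\Delta^\epsilon f(x;\vec u)=\sum_{I\in\mathcal C^\epsilon_k}f(x+\sum_{i\in I}u_i)$, where $\mathcal C^+_k$ (resp. $\mathcal C^-_k$) is the set of $I\subseteq\{1,\dots,k\}$ with $k-|I|$ even (resp. odd). $f$ is $n$-pre-stable if for all $k\in\{1,\dots,n+1\}$, all $\vec u\in P^k$ with $\sum_{i=1}^ku_i\in\mathcal B P$ and all $x\in\mathcal B(P_{\vec u})$, $\Delta^-f(x;\vec u)\le_Q\Delta^+f(x;\vec u)$; $f$ is pre-stable if it is $n$-pre-stable for all $n$. *)

theory Defs
  imports Complex_Main "HOL-Algebra.Module"
begin

text \<open>As in the module record of HOL-Algebra, the additive structure of a cone is that of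
  the ring record, whose multiplicative fields are unused. Scalars are nonnegative reals;
  the scalar multiplication at negative reals is unconstrained and never used.\<close>

record 'a normed_cone = "(real, 'a) module" +
  cone_norm :: "'a \<Rightarrow> real"

locale normed_cone = abelian_monoid P for P (structure) +
  assumes smult_closed: "\<lbrakk>0 \<le> a; x \<in> carrier P\<rbrakk> \<Longrightarrow> a \<odot>\<^bsub>P\<^esub> x \<in> carrier P"
    and smult_l_distr: "\<lbrakk>0 \<le> a; 0 \<le> b; x \<in> carrier P\<rbrakk>
      \<Longrightarrow> (a + b) \<odot>\<^bsub>P\<^esub> x = a \<odot>\<^bsub>P\<^esub> x \<oplus>\<^bsub>P\<^esub> b \<odot>\<^bsub>P\<^esub> x"
    and smult_r_distr: "\<lbrakk>0 \<le> a; x \<in> carrier P; y \<in> carrier P\<rbrakk>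
      \<Longrightarrow> a \<odot>\<^bsub>P\<^esub> (x \<oplus>\<^bsub>P\<^esub> y) = a \<odot>\<^bsub>P\<^esub> x \<oplus>\<^bsub>P\<^esub> a \<odot>\<^bsub>P\<^esub> y"
    and smult_assoc: "\<lbrakk>0 \<le> a; 0 \<le> b; x \<in> carrier P\<rbrakk>
      \<Longrightarrow> (a * b) \<odot>\<^bsub>P\<^esub> x = a \<odot>\<^bsub>P\<^esub> (b \<odot>\<^bsub>P\<^esub> x)"
    and smult_one: "x \<in> carrier P \<Longrightarrow> 1 \<odot>\<^bsub>P\<^esub> x = x"
    and smult_l_null: "x \<in> carrier P \<Longrightarrow> 0 \<odot>\<^bsub>P\<^esub> x = \<zero>\<^bsub>P\<^esub>"
    and smult_r_null: "0 \<le> a \<Longrightarrow> a \<odot>\<^bsub>P\<^esub> \<zero>\<^bsub>P\<^esub> = \<zero>\<^bsub>P\<^esub>"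
    and add_cancel: "\<lbrakk>x \<in> carrier P; y \<in> carrier P; y' \<in> carrier P; x \<oplus>\<^bsub>P\<^esub> y = x \<oplus>\<^bsub>P\<^esub> y'\<rbrakk>
      \<Longrightarrow> y = y'"
    and norm_nonneg: "x \<in> carrier P \<Longrightarrow> 0 \<le> cone_norm P x"
    and norm_smult: "\<lbrakk>0 \<le> a; x \<in> carrier P\<rbrakk>
      \<Longrightarrow> cone_norm P (a \<odot>\<^bsub>P\<^esub> x) = a * cone_norm P x"
    and norm_eq_0: "\<lbrakk>x \<in> carrier P; cone_norm P x = 0\<rbrakk> \<Longrightarrow> x = \<zero>\<^bsub>P\<^esub>"
    and norm_triangle: "\<lbrakk>x \<in> carrier P; x' \<in> carrier P\<rbrakk>
      \<Longrightarrow> cone_norm P (x \<oplus>\<^bsub>P\<^esub> x') \<le> cone_norm P x + cone_norm P x'"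
    and norm_mono: "\<lbrakk>x \<in> carrier P; x' \<in> carrier P\<rbrakk>
      \<Longrightarrow> cone_norm P x \<le> cone_norm P (x \<oplus>\<^bsub>P\<^esub> x')"

definition cone_ball :: "'a normed_cone \<Rightarrow> 'a set" where
  "cone_ball P = {x \<in> carrier P. cone_norm P x \<le> 1}"

definition cone_le :: "'a normed_cone \<Rightarrow> 'a \<Rightarrow> 'a \<Rightarrow> bool" where
  "cone_le P x x' \<longleftrightarrow>
     x \<in> carrier P \<and> x' \<in> carrier P \<and> (\<exists>y \<in> carrier P. x' = x \<oplus>\<^bsub>P\<^esub> y)"

text \<open>Only meaningful when \<^term>\<open>cone_le P x x'\<close> holds; then the witness is unique
  by cancellation.\<close>

definition cone_diff :: "'a normed_cone \<Rightarrow> 'a \<Rightarrow> 'a \<Rightarrow> 'a" where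
  "cone_diff P x' x = (THE y. y \<in> carrier P \<and> x' = x \<oplus>\<^bsub>P\<^esub> y)"

definition local_cone :: "'a normed_cone \<Rightarrow> 'a \<Rightarrow> 'a normed_cone" where
  "local_cone P u = P\<lparr>
     carrier := {x \<in> carrier P. \<exists>e>0. e \<odot>\<^bsub>P\<^esub> x \<oplus>\<^bsub>P\<^esub> u \<in> cone_ball P},
     cone_norm := (\<lambda>x. Inf {1 / e | e. 0 < e \<and> e \<odot>\<^bsub>P\<^esub> x \<oplus>\<^bsub>P\<^esub> u \<in> cone_ball P})\<rparr>"

text \<open>A function from the unit ball of \<open>P\<close> to \<open>Q\<close> is a total function of the underlying
  types; the predicates below only inspect its values on \<open>cone_ball P\<close>.\<close>

primrec n_non_decreasing ::
  "nat \<Rightarrow> 'a normed_cone \<Rightarrow> 'b normed_cone \<Rightarrow> ('a \<Rightarrow> 'b) \<Rightarrow> bool" where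
  "n_non_decreasing 0 P Q f \<longleftrightarrow>
     monotone_on (cone_ball P) (cone_le P) (cone_le Q) f"
| "n_non_decreasing (Suc n) P Q f \<longleftrightarrow>
     monotone_on (cone_ball P) (cone_le P) (cone_le Q) f \<and>
     (\<forall>u \<in> cone_ball P.
        n_non_decreasing n (local_cone P u) Q (\<lambda>x. cone_diff Q (f (x \<oplus>\<^bsub>P\<^esub> u)) (f x)))"

definition absolutely_monotonic ::
  "'a normed_cone \<Rightarrow> 'b normed_cone \<Rightarrow> ('a \<Rightarrow> 'b) \<Rightarrow> bool" where
  "absolutely_monotonic P Q f \<longleftrightarrow> (\<forall>n. n_non_decreasing n P Q f)"

text \<open>A sequence in \<open>P\<close> of length \<open>k\<close> is a function \<open>u\<close> on naturals, used on \<open>{1..k}\<close> only.\<close>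

definition Delta_plus ::
  "'a normed_cone \<Rightarrow> 'b normed_cone \<Rightarrow> ('a \<Rightarrow> 'b) \<Rightarrow> nat \<Rightarrow> 'a \<Rightarrow> (nat \<Rightarrow> 'a) \<Rightarrow> 'b" where
  "Delta_plus P Q f k x u =
     (\<Oplus>\<^bsub>Q\<^esub>I \<in> {I. I \<subseteq> {1..k} \<and> even (k - card I)}. f (x \<oplus>\<^bsub>P\<^esub> (\<Oplus>\<^bsub>P\<^esub>i \<in> I. u i)))"

definition Delta_minus ::
  "'a normed_cone \<Rightarrow> 'b normed_cone \<Rightarrow> ('a \<Rightarrow> 'b) \<Rightarrow> nat \<Rightarrow> 'a \<Rightarrow> (nat \<Rightarrow> 'a) \<Rightarrow> 'b" where
  "Delta_minus P Q f k x u =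
     (\<Oplus>\<^bsub>Q\<^esub>I \<in> {I. I \<subseteq> {1..k} \<and> odd (k - card I)}. f (x \<oplus>\<^bsub>P\<^esub> (\<Oplus>\<^bsub>P\<^esub>i \<in> I. u i)))"

definition n_pre_stable ::
  "nat \<Rightarrow> 'a normed_cone \<Rightarrow> 'b normed_cone \<Rightarrow> ('a \<Rightarrow> 'b) \<Rightarrow> bool" where
  "n_pre_stable n P Q f \<longleftrightarrow>
     (\<forall>k \<in> {1..n + 1}. \<forall>u \<in> {1..k} \<rightarrow> carrier P.
        (\<Oplus>\<^bsub>P\<^esub>i \<in> {1..k}. u i) \<in> cone_ball P \<longrightarrow>
        (\<forall>x \<in> cone_ball (local_cone P (\<Oplus>\<^bsub>P\<^esub>i \<in> {1..k}. u i)).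
           cone_le Q (Delta_minus P Q f k x u) (Delta_plus P Q f k x u)))"

definition pre_stable ::
  "'a normed_cone \<Rightarrow> 'b normed_cone \<Rightarrow> ('a \<Rightarrow> 'b) \<Rightarrow> bool" where
  "pre_stable P Q f \<longleftrightarrow> (\<forall>n. n_pre_stable n P Q f)"

end

theory Submission
  imports Defs
begin

text \<open>
  Put \<open>g y = f (y + v) - f y\<close>, a function on the ball of the local cone at \<open>v\<close>. Splitting the
  subsets of \<open>{1..k+1}\<close> according to whether they contain \<open>k+1\<close>, with \<open>v = u\<^bsub>k+1\<^esub>\<close>, shows that both
  \<open>\<Delta>\<^sup>+ f(x; u\<^sub>1,\<dots>,u\<^bsub>k+1\<^esub>)\<close> and \<open>\<Delta>\<^sup>- f(x; u\<^sub>1,\<dots>,u\<^bsub>k+1\<^esub>)\<close> arise from \<open>\<Delta>\<^sup>+ g(x; u\<^sub>1,\<dots>,u\<^sub>k)\<close> and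
  \<open>\<Delta>\<^sup>- g(x; u\<^sub>1,\<dots>,u\<^sub>k)\<close> by adding the same element \<open>\<Delta>\<^sup>+ f(x; u\<^sub>1,\<dots>,u\<^sub>k) + \<Delta>\<^sup>- f(x; u\<^sub>1,\<dots>,u\<^sub>k)\<close>.
  By cancellation the inequality for \<open>f\<close> at order \<open>k+1\<close> is the inequality for \<open>g\<close> at order \<open>k\<close>,
  and the theorem follows by induction on \<open>n\<close>, for all cones and functions simultaneously.
\<close>

section \<open>Balls and the cone order\<close>

lemma cone_ballD: "x \<in> cone_ball P \<Longrightarrow> x \<in> carrier P"
  by (simp add: cone_ball_def)

context normed_cone
begin

lemma cancel_add_left_iff:
  assumes "s \<in> carrier P" "a \<in> carrier P" "b \<in> carrier P"
  shows "s \<oplus> a = s \<oplus> b \<longleftrightarrow> a = b"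
  using add_cancel assms by blast

end

lemma cone_ball_summand:
  assumes "normed_cone P" "x \<in> carrier P" "y \<in> carrier P" "x \<oplus>\<^bsub>P\<^esub> y \<in> cone_ball P"
  shows "x \<in> cone_ball P"
proof -
  interpret P: normed_cone P by fact
  show ?thesis using P.norm_mono[of x y] assms by (simp add: cone_ball_def)
qed

lemma cone_ball_convex:
  assumes "normed_cone P" "x \<in> cone_ball P" "y \<in> cone_ball P" "0 \<le> a" "0 \<le> b" "a + b = 1"
  shows "a \<odot>\<^bsub>P\<^esub> x \<oplus>\<^bsub>P\<^esub> b \<odot>\<^bsub>P\<^esub> y \<in> cone_ball P"
proof -
  interpret P: normed_cone P by fact
  have c: "x \<in> carrier P" "y \<in> carrier P" and n: "cone_norm P x \<le> 1" "cone_norm P y \<le> 1"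
    using assms by (auto simp: cone_ball_def)
  have ca: "a \<odot>\<^bsub>P\<^esub> x \<in> carrier P" "b \<odot>\<^bsub>P\<^esub> y \<in> carrier P"
    using c assms by (auto simp: P.smult_closed)
  have "cone_norm P (a \<odot>\<^bsub>P\<^esub> x \<oplus>\<^bsub>P\<^esub> b \<odot>\<^bsub>P\<^esub> y) \<le> a * cone_norm P x + b * cone_norm P y"
    using P.norm_triangle[OF ca] c assms by (simp add: P.norm_smult)
  also have "\<dots> \<le> a * 1 + b * 1"
    using n assms by (intro add_mono mult_left_mono) auto
  finally show ?thesis using ca assms by (simp add: cone_ball_def)
qed

text \<open>A witness for one inequality is a witness for the other: associativity moves the common
  summand out and cancellation removes it. This is what strips the shared terms from
  \<open>Delta_minus\<close> and \<open>Delta_plus\<close> when the order drops by one.\<close>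

lemma cone_le_add_left_iff:
  assumes "normed_cone Q" "s \<in> carrier Q" "a \<in> carrier Q" "b \<in> carrier Q"
  shows "cone_le Q (s \<oplus>\<^bsub>Q\<^esub> a) (s \<oplus>\<^bsub>Q\<^esub> b) \<longleftrightarrow> cone_le Q a b"
proof -
  interpret Q: normed_cone Q by fact
  show ?thesis using assms by (auto simp: cone_le_def Q.a_assoc Q.cancel_add_left_iff)
qed

text \<open>Cancellation gives the uniqueness that turns the definite description in
  \<open>cone_diff\<close> into an actual difference.\<close>

lemma add_cone_diff:
  assumes "normed_cone Q" "cone_le Q a b"
  shows "cone_diff Q b a \<in> carrier Q" "b = a \<oplus>\<^bsub>Q\<^esub> cone_diff Q b a"
proof -
  interpret Q: normed_cone Q by fact
  obtain y where y: "y \<in> carrier Q" "b = a \<oplus>\<^bsub>Q\<^esub> y" and a: "a \<in> carrier Q"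
    using assms(2) unfolding cone_le_def by blast
  have "cone_diff Q b a = y"
    unfolding cone_diff_def y(2) using y(1) a Q.cancel_add_left_iff[OF a]
    by (intro the_equality) auto
  then show "cone_diff Q b a \<in> carrier Q" "b = a \<oplus>\<^bsub>Q\<^esub> cone_diff Q b a"
    using y by simp_all
qed

section \<open>Local cones\<close>

lemma local_cone_simps [simp]:
  "add (local_cone P u) = add P" "zero (local_cone P u) = zero P"
  "smult (local_cone P u) = smult P"
  by (simp_all add: local_cone_def)

text \<open>The substitution r = 1/e. In this form r is a candidate value of the local norm, so
  gauge conditions can be read as upper bounds on that norm.\<close>

lemma carrier_local_cone:
  "carrier (local_cone P u)
     = {x \<in> carrier P. \<exists>r>0. (1 / r) \<odot>\<^bsub>P\<^esub> x \<oplus>\<^bsub>P\<^esub> u \<in> cone_ball P}"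
proof -
  have "(\<exists>e>0. e \<odot>\<^bsub>P\<^esub> x \<oplus>\<^bsub>P\<^esub> u \<in> cone_ball P)
      \<longleftrightarrow> (\<exists>r>0. (1 / r) \<odot>\<^bsub>P\<^esub> x \<oplus>\<^bsub>P\<^esub> u \<in> cone_ball P)" for x
  proof
    assume "\<exists>e>0. e \<odot>\<^bsub>P\<^esub> x \<oplus>\<^bsub>P\<^esub> u \<in> cone_ball P"
    then obtain e where "e > 0" "e \<odot>\<^bsub>P\<^esub> x \<oplus>\<^bsub>P\<^esub> u \<in> cone_ball P" by blast
    then show "\<exists>r>0. (1 / r) \<odot>\<^bsub>P\<^esub> x \<oplus>\<^bsub>P\<^esub> u \<in> cone_ball P"
      by (intro exI[of _ "1 / e"]) auto
  next
    assume "\<exists>r>0. (1 / r) \<odot>\<^bsub>P\<^esub> x \<oplus>\<^bsub>P\<^esub> u \<in> cone_ball P"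
    then obtain r where "r > 0" "(1 / r) \<odot>\<^bsub>P\<^esub> x \<oplus>\<^bsub>P\<^esub> u \<in> cone_ball P" by blast
    then show "\<exists>e>0. e \<odot>\<^bsub>P\<^esub> x \<oplus>\<^bsub>P\<^esub> u \<in> cone_ball P"
      by (intro exI[of _ "1 / r"]) auto
  qed
  then show ?thesis by (simp add: local_cone_def)
qed

section \<open>The gauge that defines the local norm\<close>

lemma local_gauge_mono:
  assumes "normed_cone P" "u \<in> cone_ball P" "x \<in> carrier P" "0 < r" "r \<le> s"
    and "(1 / r) \<odot>\<^bsub>P\<^esub> x \<oplus>\<^bsub>P\<^esub> u \<in> cone_ball P"
  shows "(1 / s) \<odot>\<^bsub>P\<^esub> x \<oplus>\<^bsub>P\<^esub> u \<in> cone_ball P"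
proof -
  interpret P: normed_cone P by fact
  have u: "u \<in> carrier P" using assms(2) by (rule cone_ballD)
  have d: "0 \<le> 1 / r - 1 / s" "0 \<le> 1 / s" using assms by (auto simp: frac_le)
  have c: "(1 / s) \<odot>\<^bsub>P\<^esub> x \<in> carrier P" "(1 / r - 1 / s) \<odot>\<^bsub>P\<^esub> x \<in> carrier P"
    using assms d by (auto intro!: P.smult_closed)
  \<comment> \<open>Enlarging r to s only removes the summand (1/r - 1/s)x, and the ball is closed
    under taking summands. Hence the admissible r are upward closed.\<close>
  have "(1 / r) \<odot>\<^bsub>P\<^esub> x = (1 / s) \<odot>\<^bsub>P\<^esub> x \<oplus>\<^bsub>P\<^esub> (1 / r - 1 / s) \<odot>\<^bsub>P\<^esub> x"
    using P.smult_l_distr[OF d(2,1) \<open>x \<in> carrier P\<close>] by simp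
  then have "(1 / r) \<odot>\<^bsub>P\<^esub> x \<oplus>\<^bsub>P\<^esub> u
      = ((1 / s) \<odot>\<^bsub>P\<^esub> x \<oplus>\<^bsub>P\<^esub> u) \<oplus>\<^bsub>P\<^esub> (1 / r - 1 / s) \<odot>\<^bsub>P\<^esub> x"
    using c u by (simp add: P.a_ac)
  then have "((1 / s) \<odot>\<^bsub>P\<^esub> x \<oplus>\<^bsub>P\<^esub> u) \<oplus>\<^bsub>P\<^esub> (1 / r - 1 / s) \<odot>\<^bsub>P\<^esub> x \<in> cone_ball P"
    using assms(6) by (rule subst)
  from cone_ball_summand[OF assms(1) _ _ this] show ?thesis using c u by simp
qed

text \<open>Convexity of the ball, with weights a/(a+b) and b/(a+b): they turn both 1/a and 1/b into
  1/(a+b), and the two weighted copies of u recombine to u. This subadditivity becomes the triangle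
  inequality of the local norm.\<close>

lemma local_gauge_add:
  assumes "normed_cone P" "u \<in> cone_ball P" "x \<in> carrier P" "y \<in> carrier P" "0 < a" "0 < b"
    and "(1 / a) \<odot>\<^bsub>P\<^esub> x \<oplus>\<^bsub>P\<^esub> u \<in> cone_ball P" "(1 / b) \<odot>\<^bsub>P\<^esub> y \<oplus>\<^bsub>P\<^esub> u \<in> cone_ball P"
  shows "(1 / (a + b)) \<odot>\<^bsub>P\<^esub> (x \<oplus>\<^bsub>P\<^esub> y) \<oplus>\<^bsub>P\<^esub> u \<in> cone_ball P"
proof -
  interpret P: normed_cone P by fact
  have u: "u \<in> carrier P" using assms(2) by (rule cone_ballD)
  define s t where "s = a / (a + b)" and "t = b / (a + b)"
  have st: "0 \<le> s" "0 \<le> t" "s + t = 1"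
    using assms by (auto simp: s_def t_def add_divide_distrib[symmetric])
  have sa: "s * (1 / a) = 1 / (a + b)" "t * (1 / b) = 1 / (a + b)"
    using assms by (auto simp: s_def t_def)
  have c: "(1 / a) \<odot>\<^bsub>P\<^esub> x \<in> carrier P" "(1 / b) \<odot>\<^bsub>P\<^esub> y \<in> carrier P"
      "s \<odot>\<^bsub>P\<^esub> u \<in> carrier P" "t \<odot>\<^bsub>P\<^esub> u \<in> carrier P"
      "(1 / (a + b)) \<odot>\<^bsub>P\<^esub> x \<in> carrier P" "(1 / (a + b)) \<odot>\<^bsub>P\<^esub> y \<in> carrier P"
    using assms u st by (auto intro!: P.smult_closed)
  have x: "s \<odot>\<^bsub>P\<^esub> ((1 / a) \<odot>\<^bsub>P\<^esub> x \<oplus>\<^bsub>P\<^esub> u) = (1 / (a + b)) \<odot>\<^bsub>P\<^esub> x \<oplus>\<^bsub>P\<^esub> s \<odot>\<^bsub>P\<^esub> u"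
  proof -
    have "s \<odot>\<^bsub>P\<^esub> ((1 / a) \<odot>\<^bsub>P\<^esub> x) = (1 / (a + b)) \<odot>\<^bsub>P\<^esub> x"
      using P.smult_assoc[of s "1 / a" x] st assms(3-6) unfolding sa by simp
    then show ?thesis using P.smult_r_distr[of s "(1 / a) \<odot>\<^bsub>P\<^esub> x" u] st(1,2) c(1,2) u by simp
  qed
  have y: "t \<odot>\<^bsub>P\<^esub> ((1 / b) \<odot>\<^bsub>P\<^esub> y \<oplus>\<^bsub>P\<^esub> u) = (1 / (a + b)) \<odot>\<^bsub>P\<^esub> y \<oplus>\<^bsub>P\<^esub> t \<odot>\<^bsub>P\<^esub> u"
  proof -
    have "t \<odot>\<^bsub>P\<^esub> ((1 / b) \<odot>\<^bsub>P\<^esub> y) = (1 / (a + b)) \<odot>\<^bsub>P\<^esub> y"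
      using P.smult_assoc[of t "1 / b" y] st assms(3-6) unfolding sa by simp
    then show ?thesis using P.smult_r_distr[of t "(1 / b) \<odot>\<^bsub>P\<^esub> y" u] st(1,2) c(1,2) u by simp
  qed
  have u': "s \<odot>\<^bsub>P\<^esub> u \<oplus>\<^bsub>P\<^esub> t \<odot>\<^bsub>P\<^esub> u = u"
    using P.smult_l_distr[OF st(1,2) u] unfolding st(3) by (simp add: u P.smult_one)
  let ?X = "(1 / (a + b)) \<odot>\<^bsub>P\<^esub> x" and ?Y = "(1 / (a + b)) \<odot>\<^bsub>P\<^esub> y"
  have "(?X \<oplus>\<^bsub>P\<^esub> s \<odot>\<^bsub>P\<^esub> u) \<oplus>\<^bsub>P\<^esub> (?Y \<oplus>\<^bsub>P\<^esub> t \<odot>\<^bsub>P\<^esub> u)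
      = (?X \<oplus>\<^bsub>P\<^esub> ?Y) \<oplus>\<^bsub>P\<^esub> (s \<odot>\<^bsub>P\<^esub> u \<oplus>\<^bsub>P\<^esub> t \<odot>\<^bsub>P\<^esub> u)"
    using c by (simp add: P.a_ac)
  also have "\<dots> = (1 / (a + b)) \<odot>\<^bsub>P\<^esub> (x \<oplus>\<^bsub>P\<^esub> y) \<oplus>\<^bsub>P\<^esub> u"
    using assms by (simp add: u' P.smult_r_distr)
  finally show ?thesis
    using cone_ball_convex[OF assms(1) assms(7,8) st] by (simp add: x y)
qed

text \<open>The infimum defining the local norm is attained, because the norm is continuous along rays.\<close>

lemma local_norm_le_iff:
  assumes "normed_cone P" "u \<in> cone_ball P" "x \<in> carrier (local_cone P u)" "0 < r"
  shows "cone_norm (local_cone P u) x \<le> r \<longleftrightarrow> (1 / r) \<odot>\<^bsub>P\<^esub> x \<oplus>\<^bsub>P\<^esub> u \<in> cone_ball P"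
proof -
  interpret P: normed_cone P by fact
  have u: "u \<in> carrier P" using assms(2) by (rule cone_ballD)
  have x: "x \<in> carrier P" using assms by (simp add: carrier_local_cone)
  define S where "S = {1 / e | e. 0 < e \<and> e \<odot>\<^bsub>P\<^esub> x \<oplus>\<^bsub>P\<^esub> u \<in> cone_ball P}"
  have S_iff: "s \<in> S \<longleftrightarrow> 0 < s \<and> (1 / s) \<odot>\<^bsub>P\<^esub> x \<oplus>\<^bsub>P\<^esub> u \<in> cone_ball P" for s
  proof
    assume "0 < s \<and> (1 / s) \<odot>\<^bsub>P\<^esub> x \<oplus>\<^bsub>P\<^esub> u \<in> cone_ball P"
    then show "s \<in> S" unfolding S_def by (intro CollectI exI[of _ "1 / s"]) auto
  qed (auto simp: S_def)
  have N: "cone_norm (local_cone P u) x = Inf S" by (simp add: local_cone_def S_def)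
  have bdd: "bdd_below S" by (rule bdd_belowI[of _ 0]) (auto simp: S_iff)
  have ne: "S \<noteq> {}" using assms(3) S_iff by (auto simp: carrier_local_cone)
  show ?thesis
  proof
    assume "(1 / r) \<odot>\<^bsub>P\<^esub> x \<oplus>\<^bsub>P\<^esub> u \<in> cone_ball P"
    then show "cone_norm (local_cone P u) x \<le> r"
      unfolding N using assms S_iff bdd by (intro cInf_lower) auto
  next
    assume le: "cone_norm (local_cone P u) x \<le> r"
    \<comment> \<open>Bounds strictly above r come first: the infimum lies below s, so some element
      t of \<open>S\<close> does too, and admissibility passes from t up to s.\<close>
    have gt: "(1 / s) \<odot>\<^bsub>P\<^esub> x \<oplus>\<^bsub>P\<^esub> u \<in> cone_ball P" if "r < s" for s
    proof -
      have "Inf S < s" using le that N by simp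
      then obtain t where "t \<in> S" "t < s" using cInf_lessD[OF ne] by blast
      then show ?thesis using local_gauge_mono[OF assms(1,2) x, of t s] S_iff by auto
    qed
    have cr: "(1 / r) \<odot>\<^bsub>P\<^esub> x \<in> carrier P" using x assms by (auto intro!: P.smult_closed)
    \<comment> \<open>Passing from s down to r adds the summand (1/r - 1/s)x, whose norm tends to 0
      as s decreases to r. The bound 1 therefore survives in the limit.\<close>
    have "cone_norm P ((1 / r) \<odot>\<^bsub>P\<^esub> x \<oplus>\<^bsub>P\<^esub> u) \<le> 1 + (1 / r - 1 / s) * cone_norm P x"
      if "r < s" for s
    proof -
      have d: "0 \<le> 1 / r - 1 / s" "0 \<le> 1 / s" using assms that by (auto simp: frac_le)
      have c: "(1 / s) \<odot>\<^bsub>P\<^esub> x \<in> carrier P" "(1 / r - 1 / s) \<odot>\<^bsub>P\<^esub> x \<in> carrier P"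
        using x d by (auto intro!: P.smult_closed)
      have "(1 / r) \<odot>\<^bsub>P\<^esub> x = (1 / s) \<odot>\<^bsub>P\<^esub> x \<oplus>\<^bsub>P\<^esub> (1 / r - 1 / s) \<odot>\<^bsub>P\<^esub> x"
        using P.smult_l_distr[OF d(2,1) x] by simp
      then have "(1 / r) \<odot>\<^bsub>P\<^esub> x \<oplus>\<^bsub>P\<^esub> u
          = ((1 / s) \<odot>\<^bsub>P\<^esub> x \<oplus>\<^bsub>P\<^esub> u) \<oplus>\<^bsub>P\<^esub> (1 / r - 1 / s) \<odot>\<^bsub>P\<^esub> x"
        using c u by (simp add: P.a_ac)
      then have "cone_norm P ((1 / r) \<odot>\<^bsub>P\<^esub> x \<oplus>\<^bsub>P\<^esub> u)
          \<le> cone_norm P ((1 / s) \<odot>\<^bsub>P\<^esub> x \<oplus>\<^bsub>P\<^esub> u) + (1 / r - 1 / s) * cone_norm P x"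
        using P.norm_triangle[of "(1 / s) \<odot>\<^bsub>P\<^esub> x \<oplus>\<^bsub>P\<^esub> u" "(1 / r - 1 / s) \<odot>\<^bsub>P\<^esub> x"] c u x d
        by (simp add: P.norm_smult)
      then show ?thesis using gt[OF that] by (simp add: cone_ball_def)
    qed
    then have ev: "\<forall>\<^sub>F s in at_right r. cone_norm P ((1 / r) \<odot>\<^bsub>P\<^esub> x \<oplus>\<^bsub>P\<^esub> u)
        \<le> 1 + (1 / r - 1 / s) * cone_norm P x"
      by (simp add: eventually_at_filter)
    have "((\<lambda>s. 1 + (1 / r - 1 / s) * cone_norm P x) \<longlongrightarrow> 1 + (1 / r - 1 / r) * cone_norm P x)
        (at_right r)"
      using assms by (intro tendsto_intros) auto
    then have "cone_norm P ((1 / r) \<odot>\<^bsub>P\<^esub> x \<oplus>\<^bsub>P\<^esub> u) \<le> 1 + (1 / r - 1 / r) * cone_norm P x"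
      by (rule tendsto_lowerbound[OF _ ev]) simp
    then show "(1 / r) \<odot>\<^bsub>P\<^esub> x \<oplus>\<^bsub>P\<^esub> u \<in> cone_ball P"
      using cr u by (simp add: cone_ball_def)
  qed
qed

text \<open>The case r = 1 of the gauge characterisation. The arguments on finite differences see
  the local ball through this description and never return to the infimum.\<close>

lemma cone_ball_local_cone:
  assumes "normed_cone P" "u \<in> cone_ball P"
  shows "cone_ball (local_cone P u) = {x \<in> carrier P. x \<oplus>\<^bsub>P\<^esub> u \<in> cone_ball P}"
proof -
  interpret P: normed_cone P by fact
  have "x \<in> carrier (local_cone P u)" if "x \<in> carrier P" "x \<oplus>\<^bsub>P\<^esub> u \<in> cone_ball P" for x
    using that unfolding carrier_local_cone
    by (auto intro!: exI[of _ 1] simp: P.smult_one)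
  then show ?thesis
    using local_norm_le_iff[OF assms, of _ 1]
    by (auto simp: cone_ball_def[of "local_cone P u"] P.smult_one carrier_local_cone)
qed

lemma local_norm_nonneg:
  assumes "x \<in> carrier (local_cone P u)"
  shows "0 \<le> cone_norm (local_cone P u) x"
proof -
  have "0 \<le> Inf {1 / e | e. 0 < e \<and> e \<odot>\<^bsub>P\<^esub> x \<oplus>\<^bsub>P\<^esub> u \<in> cone_ball P}"
    using assms by (intro cInf_greatest) (auto simp: local_cone_def)
  then show ?thesis by (simp add: local_cone_def)
qed

section \<open>The local cone is a cone\<close>

lemma local_cone_summand:
  assumes "normed_cone P" "u \<in> cone_ball P" "x \<in> carrier P" "y \<in> carrier P" "0 < r"
    and "(1 / r) \<odot>\<^bsub>P\<^esub> (x \<oplus>\<^bsub>P\<^esub> y) \<oplus>\<^bsub>P\<^esub> u \<in> cone_ball P"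
  shows "(1 / r) \<odot>\<^bsub>P\<^esub> x \<oplus>\<^bsub>P\<^esub> u \<in> cone_ball P"
proof -
  interpret P: normed_cone P by fact
  have u: "u \<in> carrier P" using assms(2) by (rule cone_ballD)
  have c: "(1 / r) \<odot>\<^bsub>P\<^esub> x \<in> carrier P" "(1 / r) \<odot>\<^bsub>P\<^esub> y \<in> carrier P"
    using assms by (auto intro!: P.smult_closed)
  have "(1 / r) \<odot>\<^bsub>P\<^esub> (x \<oplus>\<^bsub>P\<^esub> y) \<oplus>\<^bsub>P\<^esub> u = ((1 / r) \<odot>\<^bsub>P\<^esub> x \<oplus>\<^bsub>P\<^esub> u) \<oplus>\<^bsub>P\<^esub> (1 / r) \<odot>\<^bsub>P\<^esub> y"
    using assms c u by (simp add: P.smult_r_distr P.a_ac)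
  then have "((1 / r) \<odot>\<^bsub>P\<^esub> x \<oplus>\<^bsub>P\<^esub> u) \<oplus>\<^bsub>P\<^esub> (1 / r) \<odot>\<^bsub>P\<^esub> y \<in> cone_ball P"
    using assms(6) by (rule subst)
  from cone_ball_summand[OF assms(1) _ _ this] show ?thesis using c u by simp
qed

lemma local_cone_add_closed:
  assumes "normed_cone P" "u \<in> cone_ball P"
    and "x \<in> carrier (local_cone P u)" "y \<in> carrier (local_cone P u)"
  shows "x \<oplus>\<^bsub>P\<^esub> y \<in> carrier (local_cone P u)"
proof -
  interpret P: normed_cone P by fact
  obtain a b where ab: "0 < a" "(1 / a) \<odot>\<^bsub>P\<^esub> x \<oplus>\<^bsub>P\<^esub> u \<in> cone_ball P"
      "0 < b" "(1 / b) \<odot>\<^bsub>P\<^esub> y \<oplus>\<^bsub>P\<^esub> u \<in> cone_ball P"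
      and c: "x \<in> carrier P" "y \<in> carrier P"
    using assms by (auto simp: carrier_local_cone)
  have "0 < a + b" "(1 / (a + b)) \<odot>\<^bsub>P\<^esub> (x \<oplus>\<^bsub>P\<^esub> y) \<oplus>\<^bsub>P\<^esub> u \<in> cone_ball P"
    using local_gauge_add[OF assms(1,2) c] ab by auto
  then show ?thesis using c by (auto simp: carrier_local_cone)
qed

lemma local_gauge_smult_iff:
  assumes "normed_cone P" "x \<in> carrier P" "0 < a" "0 < r"
  shows "(1 / r) \<odot>\<^bsub>P\<^esub> (a \<odot>\<^bsub>P\<^esub> x) \<oplus>\<^bsub>P\<^esub> u \<in> cone_ball P
    \<longleftrightarrow> (1 / (r / a)) \<odot>\<^bsub>P\<^esub> x \<oplus>\<^bsub>P\<^esub> u \<in> cone_ball P"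
proof -
  interpret P: normed_cone P by fact
  show ?thesis using assms P.smult_assoc[of "1 / r" a x] by simp
qed

lemma local_cone_zero_closed:
  assumes "normed_cone P" "u \<in> cone_ball P"
  shows "\<zero>\<^bsub>P\<^esub> \<in> carrier (local_cone P u)"
proof -
  interpret P: normed_cone P by fact
  show ?thesis using assms(2) cone_ballD[OF assms(2)]
    by (auto simp: carrier_local_cone P.smult_r_null intro!: exI[of _ 1])
qed

lemma local_cone_smult_closed:
  assumes "normed_cone P" "u \<in> cone_ball P" "x \<in> carrier (local_cone P u)" "0 \<le> a"
  shows "a \<odot>\<^bsub>P\<^esub> x \<in> carrier (local_cone P u)"
proof (cases "a = 0")
  interpret P: normed_cone P by fact
  case True
  then show ?thesis
    using assms local_cone_zero_closed[OF assms(1,2)] by (simp add: carrier_local_cone P.smult_l_null)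
next
  interpret P: normed_cone P by fact
  case False
  obtain r where r: "0 < r" "(1 / r) \<odot>\<^bsub>P\<^esub> x \<oplus>\<^bsub>P\<^esub> u \<in> cone_ball P" and x: "x \<in> carrier P"
    using assms by (auto simp: carrier_local_cone)
  have "(1 / (r * a)) \<odot>\<^bsub>P\<^esub> (a \<odot>\<^bsub>P\<^esub> x) \<oplus>\<^bsub>P\<^esub> u \<in> cone_ball P"
    using local_gauge_smult_iff[OF assms(1) x, of a "r * a"] False assms r by simp
  moreover have "0 < r * a" using r False assms by simp
  ultimately show ?thesis
    using x assms by (auto simp: carrier_local_cone P.smult_closed)
qed

text \<open>Scaling x by a is the same as replacing the bound r by r/a in the gauge condition.
  Homogeneity follows, since two nonnegative reals with the same positive upper bounds are
  equal.\<close>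

lemma local_norm_le_scaled_iff:
  assumes "normed_cone P" "u \<in> cone_ball P" "x \<in> carrier (local_cone P u)" "0 < a" "0 < r"
  shows "cone_norm (local_cone P u) (a \<odot>\<^bsub>P\<^esub> x) \<le> r
    \<longleftrightarrow> a * cone_norm (local_cone P u) x \<le> r"
proof -
  have "x \<in> carrier P" using assms by (simp add: carrier_local_cone)
  then have "cone_norm (local_cone P u) (a \<odot>\<^bsub>P\<^esub> x) \<le> r
      \<longleftrightarrow> cone_norm (local_cone P u) x \<le> r / a"
    using assms local_gauge_smult_iff[OF assms(1), of x a r u]
      local_norm_le_iff[OF assms(1,2), of x "r / a"]
      local_norm_le_iff[OF assms(1,2) local_cone_smult_closed[OF assms(1-3)], of a r] by auto
  then show ?thesis using assms by (simp add: field_simps)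
qed

text \<open>The main induction replaces P by a local cone, so the local cone must itself satisfy
  every cone axiom. The algebraic laws are inherited from P, and each norm axiom reduces to a gauge
  fact.\<close>

lemma normed_cone_local_cone:
  assumes "normed_cone P" "u \<in> cone_ball P"
  shows "normed_cone (local_cone P u)"
proof -
  interpret P: normed_cone P by fact
  let ?L = "local_cone P u"
  note nle = local_norm_le_iff[OF assms]
  have sub: "x \<in> carrier P" if "x \<in> carrier ?L" for x using that by (simp add: carrier_local_cone)
  have smult: "cone_norm ?L (a \<odot>\<^bsub>P\<^esub> x) = a * cone_norm ?L x"
    if a: "0 \<le> a" and x: "x \<in> carrier ?L" for a x
  proof (cases "a = 0")
    case True
    \<comment> \<open>At the scalar 0, homogeneity says that the local norm of zero is 0. Every
      positive r is an upper bound, because the gauge condition at zero only says that u is in the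
      ball.\<close>
    have "cone_norm ?L \<zero>\<^bsub>P\<^esub> \<le> 0 + r" if "0 < r" for r
      using nle[OF local_cone_zero_closed[OF assms] that] that assms(2) cone_ballD[OF assms(2)]
      by (simp add: P.smult_r_null)
    then have "cone_norm ?L \<zero>\<^bsub>P\<^esub> \<le> 0" by (rule field_le_epsilon)
    then show ?thesis
      using True local_norm_nonneg[OF local_cone_zero_closed[OF assms]] sub[OF x]
      by (simp add: P.smult_l_null)
  next
    case False
    then have a: "0 < a" using a by simp
    note eq = local_norm_le_scaled_iff[OF assms x a]
    have n: "0 \<le> cone_norm ?L (a \<odot>\<^bsub>P\<^esub> x)" "0 \<le> a * cone_norm ?L x"
      using a local_norm_nonneg[OF x] local_norm_nonneg[OF local_cone_smult_closed[OF assms x, of a]] by auto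
    show ?thesis
    \<comment> \<open>\<open>eq\<close> compares positive upper bounds only. Adding a positive
      epsilon makes the bound positive even if the norm on that side is 0.\<close>
    proof (rule antisym)
      show "cone_norm ?L (a \<odot>\<^bsub>P\<^esub> x) \<le> a * cone_norm ?L x"
        by (rule field_le_epsilon, rule eq[THEN iffD2]) (use n in linarith)+
      show "a * cone_norm ?L x \<le> cone_norm ?L (a \<odot>\<^bsub>P\<^esub> x)"
        by (rule field_le_epsilon, rule eq[THEN iffD1]) (use n in linarith)+
    qed
  qed
  show ?thesis
  proof (unfold_locales)
    fix x y assume x: "x \<in> carrier ?L" and y: "y \<in> carrier ?L"
    have add: "x \<oplus>\<^bsub>P\<^esub> y \<in> carrier ?L" by (rule local_cone_add_closed[OF assms x y])
    show "cone_norm ?L (x \<oplus>\<^bsub>?L\<^esub> y) \<le> cone_norm ?L x + cone_norm ?L y"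
    proof (rule field_le_epsilon)
      fix e :: real assume e: "0 < e"
      \<comment> \<open>The slack e/2 makes both gauge parameters positive, as
        \<open>local_gauge_add\<close> requires, even when a norm is 0.\<close>
      define a b where "a = cone_norm ?L x + e / 2" and "b = cone_norm ?L y + e / 2"
      have ab: "0 < a" "0 < b" "cone_norm ?L x \<le> a" "cone_norm ?L y \<le> b"
        using e local_norm_nonneg[OF x] local_norm_nonneg[OF y] by (auto simp: a_def b_def)
      have "(1 / (a + b)) \<odot>\<^bsub>P\<^esub> (x \<oplus>\<^bsub>P\<^esub> y) \<oplus>\<^bsub>P\<^esub> u \<in> cone_ball P"
        using local_gauge_add[OF assms sub[OF x] sub[OF y]] ab nle[OF x] nle[OF y] by blast
      then have "cone_norm ?L (x \<oplus>\<^bsub>P\<^esub> y) \<le> a + b" using nle[OF add, of "a + b"] ab by simp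
      then show "cone_norm ?L (x \<oplus>\<^bsub>?L\<^esub> y) \<le> cone_norm ?L x + cone_norm ?L y + e"
        by (simp add: a_def b_def)
    qed
    show "cone_norm ?L x \<le> cone_norm ?L (x \<oplus>\<^bsub>?L\<^esub> y)"
    proof (rule field_le_epsilon)
      fix e :: real assume e: "0 < e"
      define r where "r = cone_norm ?L (x \<oplus>\<^bsub>P\<^esub> y) + e"
      have r: "0 < r" "cone_norm ?L (x \<oplus>\<^bsub>P\<^esub> y) \<le> r"
        using local_norm_nonneg[OF add] e by (auto simp: r_def)
      then have "cone_norm ?L x \<le> r"
        using nle[OF add] nle[OF x] local_cone_summand[OF assms sub[OF x] sub[OF y]] by blast
      then show "cone_norm ?L x \<le> cone_norm ?L (x \<oplus>\<^bsub>?L\<^esub> y) + e" by (simp add: r_def)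
    qed
  next
    fix x assume x: "x \<in> carrier ?L" and 0: "cone_norm ?L x = 0"
    \<comment> \<open>If the local norm is 0, then (1/r)x + u is in the ball for every positive r.
      Its summand (1/r)x is too, so the original norm of x is at most r.\<close>
    have "cone_norm P x \<le> 0 + r" if r: "0 < r" for r
    proof -
      have c: "(1 / r) \<odot>\<^bsub>P\<^esub> x \<in> carrier P" using sub[OF x] r by (simp add: P.smult_closed)
      have "(1 / r) \<odot>\<^bsub>P\<^esub> x \<oplus>\<^bsub>P\<^esub> u \<in> cone_ball P" using nle[OF x r] 0 r by simp
      then have "(1 / r) \<odot>\<^bsub>P\<^esub> x \<in> cone_ball P"
        using cone_ball_summand[OF assms(1) c cone_ballD[OF assms(2)]] by simp
      then show ?thesis using r sub[OF x] by (simp add: cone_ball_def P.norm_smult field_simps)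
    qed
    then have "cone_norm P x \<le> 0" by (rule field_le_epsilon)
    then show "x = \<zero>\<^bsub>?L\<^esub>" using P.norm_nonneg[OF sub[OF x]] P.norm_eq_0[OF sub[OF x]] by simp
  qed (auto simp: smult local_norm_nonneg local_cone_smult_closed[OF assms]
      local_cone_add_closed[OF assms] local_cone_zero_closed[OF assms]
      P.smult_l_distr P.smult_r_distr P.smult_assoc P.smult_one P.smult_l_null P.smult_r_null
      P.a_ac P.cancel_add_left_iff dest!: sub)
qed

text \<open>\<open>finsum\<close> depends on the carrier, and the local cone has a possibly smaller
  one, so sharing addition and zero does not settle the equality at once. Induction on the index set
  evaluates both sums in parallel.\<close>

lemma finsum_local_cone:
  assumes "normed_cone P" "u \<in> cone_ball P" "finite A" "h \<in> A \<rightarrow> carrier (local_cone P u)"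
  shows "finsum (local_cone P u) h A = finsum P h A"
proof -
  interpret P: normed_cone P by fact
  interpret L: normed_cone "local_cone P u" by (rule normed_cone_local_cone) fact+
  show ?thesis using assms(3,4)
  proof (induction A)
    case (insert a A)
    then have "h \<in> A \<rightarrow> carrier P" "h a \<in> carrier P" by (auto simp: carrier_local_cone)
    with insert show ?case by (simp add: Pi_iff)
  qed simp
qed

section \<open>Finite differences\<close>

text \<open>If \<open>Suc k\<close> is not in I, then card I is at most k, so the truncated
  difference really grows by one and its parity flips. If \<open>Suc k\<close> is in I, removing it
  lowers both terms of the difference by one and the parity stays.\<close>

lemma subset_Suc_parity_split:
  "{I. I \<subseteq> {1..Suc k} \<and> even (Suc k - card I) = b}
     = {I. I \<subseteq> {1..k} \<and> even (k - card I) = (\<not> b)}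
       \<union> insert (Suc k) ` {I. I \<subseteq> {1..k} \<and> even (k - card I) = b}" (is "?L = ?A \<union> insert _ ` ?B")
proof -
  have le: "card I \<le> k" if "I \<subseteq> {1..k}" for I :: "nat set"
    using card_mono[OF _ that] by simp
  have ins: "card (insert (Suc k) I) = Suc (card I)" if "I \<subseteq> {1..k}" for I :: "nat set"
    using that finite_subset[OF that] by (subst card_insert_disjoint) auto
  show ?thesis
  proof (intro equalityI subsetI)
    fix I assume I: "I \<in> ?L"
    show "I \<in> ?A \<union> insert (Suc k) ` ?B"
    proof (cases "Suc k \<in> I")
      case True
      define J where "J = I - {Suc k}"
      have J: "I = insert (Suc k) J" "J \<subseteq> {1..k}" using I True by (auto simp: J_def le_Suc_eq)
      then show ?thesis using I ins[OF J(2)] by auto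
    next
      case False
      then have "I \<subseteq> {1..k}" using I by (auto simp: subset_iff le_Suc_eq)
      then show ?thesis using I le[of I] by (auto simp: Suc_diff_le)
    qed
  next
    fix I assume "I \<in> ?A \<union> insert (Suc k) ` ?B"
    then consider (out) "I \<subseteq> {1..k}" "even (k - card I) = (\<not> b)"
      | (into) J where "I = insert (Suc k) J" "J \<subseteq> {1..k}" "even (k - card J) = b" by blast
    then show "I \<in> ?L"
    proof cases
      case out
      then show ?thesis using le[of I] by (auto simp: Suc_diff_le)
    next
      case into
      then show ?thesis using ins[of J] by auto
    qed
  qed
qed

text \<open>The Boolean selects the sign, so one computation treats \<open>Delta_plus\<close> and
  \<open>Delta_minus\<close> together and the parity flip becomes negation.\<close>

definition Delta_parity ::
  "bool \<Rightarrow> 'a normed_cone \<Rightarrow> 'b normed_cone \<Rightarrow> ('a \<Rightarrow> 'b) \<Rightarrow> nat \<Rightarrow> 'a \<Rightarrow> (nat \<Rightarrow> 'a) \<Rightarrow> 'b" where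
  "Delta_parity b P Q f k x u =
     (\<Oplus>\<^bsub>Q\<^esub>I \<in> {I. I \<subseteq> {1..k} \<and> even (k - card I) = b}. f (x \<oplus>\<^bsub>P\<^esub> (\<Oplus>\<^bsub>P\<^esub>i \<in> I. u i)))"

lemma Delta_plus_parity: "Delta_plus = Delta_parity True"
  by (simp add: fun_eq_iff Delta_plus_def Delta_parity_def)

lemma Delta_minus_parity: "Delta_minus = Delta_parity False"
  by (simp add: fun_eq_iff Delta_minus_def Delta_parity_def)

text \<open>Subsets without \<open>Suc k\<close> contribute the sum of the opposite parity. On the
  others f is evaluated at y + v, which monotonicity lets one write as f y + g y. The sequence w
  need only agree with u up to k, so that u may be an extension of w by v.\<close>

lemma Delta_parity_Suc:
  assumes P: "normed_cone P" and Q: "normed_cone Q" and f: "f \<in> cone_ball P \<rightarrow> carrier Q"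
    and mono: "monotone_on (cone_ball P) (cone_le P) (cone_le Q) f"
    and u: "u \<in> {1..k} \<rightarrow> carrier P" and v: "v \<in> carrier P" "u (Suc k) = v" and x: "x \<in> carrier P"
    and ball: "x \<oplus>\<^bsub>P\<^esub> (\<Oplus>\<^bsub>P\<^esub>i \<in> {1..Suc k}. u i) \<in> cone_ball P"
    and w: "\<And>i. i \<in> {1..k} \<Longrightarrow> w i = u i"
  defines "g \<equiv> \<lambda>y. cone_diff Q (f (y \<oplus>\<^bsub>P\<^esub> v)) (f y)"
  shows "Delta_parity b P Q f k x u \<in> carrier Q"
    and "Delta_parity b (local_cone P v) Q g k x w \<in> carrier Q"
    and "Delta_parity b P Q f (Suc k) x u = Delta_parity (\<not> b) P Q f k x u \<oplus>\<^bsub>Q\<^esub>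
      (Delta_parity b P Q f k x u \<oplus>\<^bsub>Q\<^esub> Delta_parity b (local_cone P v) Q g k x w)"
proof -
  interpret P: normed_cone P by fact
  interpret Q: normed_cone Q by fact
  define s where "s I = (\<Oplus>\<^bsub>P\<^esub>i \<in> I. u i)" for I
  define T where "T b = {I. I \<subseteq> {1..k} \<and> even (k - card I) = b}" for b
  have fT: "finite (T b)" for b unfolding T_def by (rule finite_subset[of _ "Pow {1..k}"]) auto
  have uI: "u \<in> I \<rightarrow> carrier P" if "I \<subseteq> {1..k}" for I using u that by auto
  have sc: "s I \<in> carrier P" if "I \<subseteq> {1..k}" for I
    using uI[OF that] by (simp add: s_def)
  have s_ins: "s (insert (Suc k) I) = s I \<oplus>\<^bsub>P\<^esub> v" if "I \<subseteq> {1..k}" for I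
  proof -
    have "finite I" "Suc k \<notin> I" using finite_subset[OF that] that by auto
    then show ?thesis using uI[OF that] v sc[OF that] by (simp add: s_def P.a_comm)
  qed
  \<comment> \<open>The complementary sum over {1..k} - I completes this point to the one assumed in
    \<open>ball\<close>, so it is a summand of an element of the ball. All domain conditions below
    come from this fact.\<close>
  have b_big: "x \<oplus>\<^bsub>P\<^esub> s I \<oplus>\<^bsub>P\<^esub> v \<in> cone_ball P" if I: "I \<subseteq> {1..k}" for I
  proof -
    have "s {1..k} = s I \<oplus>\<^bsub>P\<^esub> s ({1..k} - I)"
    proof -
      have "I \<union> ({1..k} - I) = {1..k}" using I by auto
      moreover have "s (I \<union> ({1..k} - I)) = s I \<oplus>\<^bsub>P\<^esub> s ({1..k} - I)"
        unfolding s_def using finite_subset[OF I] uI[OF I] uI[of "{1..k} - I"]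
        by (intro P.finsum_Un_disjoint) auto
      ultimately show ?thesis by simp
    qed
    moreover have "s {1..Suc k} = s {1..k} \<oplus>\<^bsub>P\<^esub> v"
      using s_ins[of "{1..k}"] by (simp add: atLeastAtMostSuc_conv)
    ultimately have "x \<oplus>\<^bsub>P\<^esub> s {1..Suc k} = (x \<oplus>\<^bsub>P\<^esub> s I \<oplus>\<^bsub>P\<^esub> v) \<oplus>\<^bsub>P\<^esub> s ({1..k} - I)"
      using x v sc[OF I] sc[of "{1..k} - I"] by (simp add: P.a_ac)
    then have "(x \<oplus>\<^bsub>P\<^esub> s I \<oplus>\<^bsub>P\<^esub> v) \<oplus>\<^bsub>P\<^esub> s ({1..k} - I) \<in> cone_ball P"
      using ball[folded s_def] by (rule subst)
    from cone_ball_summand[OF P _ _ this] show ?thesis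
      using x v sc[OF I] sc[of "{1..k} - I"] by simp
  qed
  have b_small: "x \<oplus>\<^bsub>P\<^esub> s I \<in> cone_ball P" if I: "I \<subseteq> {1..k}" for I
    using cone_ball_summand[OF P _ v(1) b_big[OF I]] x sc[OF I] by simp
  have vb: "v \<in> cone_ball P"
    using cone_ball_summand[OF P v(1), of x] b_big[of "{}"] x v by (simp add: s_def P.a_comm)
  have le: "cone_le Q (f (x \<oplus>\<^bsub>P\<^esub> s I)) (f (x \<oplus>\<^bsub>P\<^esub> s I \<oplus>\<^bsub>P\<^esub> v))" if I: "I \<subseteq> {1..k}" for I
    using b_small[OF I] b_big[OF I] v
    by (intro monotone_onD[OF mono]) (auto simp: cone_le_def dest: cone_ballD)
  have gc: "g (x \<oplus>\<^bsub>P\<^esub> s I) \<in> carrier Q" if I: "I \<subseteq> {1..k}" for I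
    using add_cone_diff(1)[OF Q le[OF I]] by (simp add: g_def)
  have fg: "f (x \<oplus>\<^bsub>P\<^esub> s (insert (Suc k) I)) = f (x \<oplus>\<^bsub>P\<^esub> s I) \<oplus>\<^bsub>Q\<^esub> g (x \<oplus>\<^bsub>P\<^esub> s I)"
    if I: "I \<subseteq> {1..k}" for I
    using add_cone_diff(2)[OF Q le[OF I]] x v sc[OF I] by (simp add: g_def s_ins[OF I] P.a_assoc)
  have fc: "f (x \<oplus>\<^bsub>P\<^esub> s I) \<in> carrier Q" if I: "I \<subseteq> {1..k}" for I
    using f b_small[OF I] by blast
  have fc_pi: "(\<lambda>I. f (x \<oplus>\<^bsub>P\<^esub> s I)) \<in> T b \<rightarrow> carrier Q" for b
    using fc by (auto simp: T_def)
  have gc_pi: "(\<lambda>I. g (x \<oplus>\<^bsub>P\<^esub> s I)) \<in> T b \<rightarrow> carrier Q" for b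
    using gc by (auto simp: T_def)
  have Df: "Delta_parity b P Q f k x u = (\<Oplus>\<^bsub>Q\<^esub>I \<in> T b. f (x \<oplus>\<^bsub>P\<^esub> s I))" for b
    by (simp add: Delta_parity_def T_def s_def)
  \<comment> \<open>\<open>b_big\<close> at a singleton puts x + u_i + v in the ball. Dropping x
    shows that u_i is in the local ball at v, as the transfer of sums to the local cone
    requires.\<close>
  have uL: "u i \<in> carrier (local_cone P v)" if "i \<in> {1..k}" for i
  proof -
    have ui: "u i \<in> carrier P" using that u by blast
    then have "x \<oplus>\<^bsub>P\<^esub> u i \<oplus>\<^bsub>P\<^esub> v \<in> cone_ball P"
      using b_big[of "{i}"] that by (simp add: s_def)
    moreover have "x \<oplus>\<^bsub>P\<^esub> u i \<oplus>\<^bsub>P\<^esub> v = (u i \<oplus>\<^bsub>P\<^esub> v) \<oplus>\<^bsub>P\<^esub> x"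
      using ui x v by (simp add: P.a_ac)
    ultimately have "u i \<oplus>\<^bsub>P\<^esub> v \<in> cone_ball P"
      using cone_ball_summand[OF P, of "u i \<oplus>\<^bsub>P\<^esub> v" x] ui x v(1) by simp
    then have "u i \<in> cone_ball (local_cone P v)" using ui cone_ball_local_cone[OF P vb] by simp
    then show ?thesis by (rule cone_ballD)
  qed
  have sL: "finsum (local_cone P v) w I = s I" if I: "I \<subseteq> {1..k}" for I
  proof -
    have wu: "w i = u i" if "i \<in> I" for i using that I w by blast
    then have "finsum (local_cone P v) w I = finsum P w I"
      using I finite_subset[OF I] uL by (intro finsum_local_cone[OF P vb]) auto
    also have "\<dots> = s I" unfolding s_def using wu uI[OF I] by (intro P.finsum_cong') auto
    finally show ?thesis .
  qed
  have Dg: "Delta_parity b (local_cone P v) Q g k x w = (\<Oplus>\<^bsub>Q\<^esub>I \<in> T b. g (x \<oplus>\<^bsub>P\<^esub> s I))" for b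
    unfolding Delta_parity_def T_def[symmetric] using gc
    by (intro Q.finsum_cong') (auto simp: T_def sL)
  show "Delta_parity b P Q f k x u \<in> carrier Q" using fc_pi by (simp add: Df)
  show "Delta_parity b (local_cone P v) Q g k x w \<in> carrier Q" using gc_pi by (simp add: Dg)
  have inj: "inj_on (insert (Suc k)) (T b)"
    by (rule inj_onI) (auto simp: T_def dest!: insert_ident[THEN iffD1, rotated 2])
  have img: "(\<lambda>I. f (x \<oplus>\<^bsub>P\<^esub> s I)) \<in> insert (Suc k) ` T b \<rightarrow> carrier Q"
    using fg fc gc by (auto simp: T_def)
  have disj: "T (\<not> b) \<inter> insert (Suc k) ` T b = {}" by (auto simp: T_def)
  have "Delta_parity b P Q f (Suc k) x u
      = (\<Oplus>\<^bsub>Q\<^esub>I \<in> T (\<not> b) \<union> insert (Suc k) ` T b. f (x \<oplus>\<^bsub>P\<^esub> s I))"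
    unfolding Delta_parity_def T_def s_def subset_Suc_parity_split ..
  also have "\<dots> = (\<Oplus>\<^bsub>Q\<^esub>I \<in> T (\<not> b). f (x \<oplus>\<^bsub>P\<^esub> s I))
      \<oplus>\<^bsub>Q\<^esub> (\<Oplus>\<^bsub>Q\<^esub>I \<in> insert (Suc k) ` T b. f (x \<oplus>\<^bsub>P\<^esub> s I))"
    using fT fc_pi img disj by (intro Q.finsum_Un_disjoint) auto
  also have "(\<Oplus>\<^bsub>Q\<^esub>I \<in> insert (Suc k) ` T b. f (x \<oplus>\<^bsub>P\<^esub> s I))
      = (\<Oplus>\<^bsub>Q\<^esub>I \<in> T b. f (x \<oplus>\<^bsub>P\<^esub> s (insert (Suc k) I)))"
    by (rule Q.finsum_reindex[OF img inj])
  also have "\<dots> = (\<Oplus>\<^bsub>Q\<^esub>I \<in> T b. f (x \<oplus>\<^bsub>P\<^esub> s I) \<oplus>\<^bsub>Q\<^esub> g (x \<oplus>\<^bsub>P\<^esub> s I))"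
    using fc gc by (intro Q.finsum_cong') (auto simp: T_def fg)
  also have "\<dots> = (\<Oplus>\<^bsub>Q\<^esub>I \<in> T b. f (x \<oplus>\<^bsub>P\<^esub> s I)) \<oplus>\<^bsub>Q\<^esub> (\<Oplus>\<^bsub>Q\<^esub>I \<in> T b. g (x \<oplus>\<^bsub>P\<^esub> s I))"
    by (rule Q.finsum_addf[OF fc_pi gc_pi])
  finally show "Delta_parity b P Q f (Suc k) x u = Delta_parity (\<not> b) P Q f k x u \<oplus>\<^bsub>Q\<^esub>
      (Delta_parity b P Q f k x u \<oplus>\<^bsub>Q\<^esub> Delta_parity b (local_cone P v) Q g k x w)"
    by (simp only: Df Dg)
qed

text \<open>For the two parities the terms \<open>?F True\<close> and \<open>?F False\<close> appear
  in opposite orders. Commutativity makes them one common summand, which then cancels.\<close>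

lemma Delta_le_Suc_iff:
  assumes P: "normed_cone P" and Q: "normed_cone Q" and f: "f \<in> cone_ball P \<rightarrow> carrier Q"
    and mono: "monotone_on (cone_ball P) (cone_le P) (cone_le Q) f"
    and u: "u \<in> {1..k} \<rightarrow> carrier P" and v: "v \<in> carrier P" "u (Suc k) = v" and x: "x \<in> carrier P"
    and ball: "x \<oplus>\<^bsub>P\<^esub> (\<Oplus>\<^bsub>P\<^esub>i \<in> {1..Suc k}. u i) \<in> cone_ball P"
    and w: "\<And>i. i \<in> {1..k} \<Longrightarrow> w i = u i"
  defines "g \<equiv> \<lambda>y. cone_diff Q (f (y \<oplus>\<^bsub>P\<^esub> v)) (f y)"
  shows "cone_le Q (Delta_minus P Q f (Suc k) x u) (Delta_plus P Q f (Suc k) x u)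
    \<longleftrightarrow> cone_le Q (Delta_minus (local_cone P v) Q g k x w) (Delta_plus (local_cone P v) Q g k x w)"
proof -
  interpret Q: normed_cone Q by fact
  note D = Delta_parity_Suc[OF P Q f mono u v x ball w, folded g_def]
  let ?F = "\<lambda>b. Delta_parity b P Q f k x u"
  let ?G = "\<lambda>b. Delta_parity b (local_cone P v) Q g k x w"
  have "Delta_parity True P Q f (Suc k) x u = (?F False \<oplus>\<^bsub>Q\<^esub> ?F True) \<oplus>\<^bsub>Q\<^esub> ?G True"
    using D(3)[of True] D(1,2) by (simp add: Q.a_assoc)
  moreover have "Delta_parity False P Q f (Suc k) x u = (?F False \<oplus>\<^bsub>Q\<^esub> ?F True) \<oplus>\<^bsub>Q\<^esub> ?G False"
    using D(3)[of False] D(1,2) by (simp add: Q.a_ac)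
  ultimately show ?thesis
    unfolding Delta_plus_parity Delta_minus_parity
    using cone_le_add_left_iff[OF Q, of "?F False \<oplus>\<^bsub>Q\<^esub> ?F True" "?G False" "?G True"] D(1,2)
    by simp
qed

lemma Delta_1:
  assumes "normed_cone P" "normed_cone Q" "u 1 \<in> carrier P" "x \<in> carrier P"
    and "f x \<in> carrier Q" "f (x \<oplus>\<^bsub>P\<^esub> u 1) \<in> carrier Q"
  shows "Delta_minus P Q f 1 x u = f x" "Delta_plus P Q f 1 x u = f (x \<oplus>\<^bsub>P\<^esub> u 1)"
proof -
  interpret P: normed_cone P by fact
  interpret Q: normed_cone Q by fact
  have "{I. I \<subseteq> {1..1::nat} \<and> even (1 - card I)} = {{1}}"
    "{I. I \<subseteq> {1..1::nat} \<and> odd (1 - card I)} = {{}}"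
    by (auto simp: subset_singleton_iff)
  then show "Delta_minus P Q f 1 x u = f x" "Delta_plus P Q f 1 x u = f (x \<oplus>\<^bsub>P\<^esub> u 1)"
    using assms unfolding Delta_minus_def Delta_plus_def by simp_all
qed

section \<open>Non-decreasing and pre-stable functions\<close>

text \<open>The pre-stability inequality at a single order k. The two membership conditions on the
  sum and on x are merged into one condition in P, which avoids the local cone at the sum of the
  sequence.\<close>

definition Delta_nonneg :: "'a normed_cone \<Rightarrow> 'b normed_cone \<Rightarrow> ('a \<Rightarrow> 'b) \<Rightarrow> nat \<Rightarrow> bool" where
  "Delta_nonneg P Q f k \<longleftrightarrow>
     (\<forall>u \<in> {1..k} \<rightarrow> carrier P. \<forall>x \<in> carrier P.
        x \<oplus>\<^bsub>P\<^esub> (\<Oplus>\<^bsub>P\<^esub>i \<in> {1..k}. u i) \<in> cone_ball P \<longrightarrow>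
        cone_le Q (Delta_minus P Q f k x u) (Delta_plus P Q f k x u))"

text \<open>When x + s is in the ball, so is its summand s. The separate requirement on s is
  therefore implied, and membership of x in the local ball at s unfolds to the merged
  condition.\<close>

lemma n_pre_stable_iff_Delta_nonneg:
  assumes P: "normed_cone P"
  shows "n_pre_stable n P Q f \<longleftrightarrow> (\<forall>k \<in> {1..n + 1}. Delta_nonneg P Q f k)"
proof -
  interpret P: normed_cone P by fact
  have "(s \<in> cone_ball P \<longrightarrow> (\<forall>x \<in> cone_ball (local_cone P s). R x))
      \<longleftrightarrow> (\<forall>x \<in> carrier P. x \<oplus>\<^bsub>P\<^esub> s \<in> cone_ball P \<longrightarrow> R x)" if s: "s \<in> carrier P" for s R
  proof -
    have "s \<in> cone_ball P" if "x \<in> carrier P" "x \<oplus>\<^bsub>P\<^esub> s \<in> cone_ball P" for x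
      using cone_ball_summand[OF P s, of x] that s by (simp add: P.a_comm)
    then show ?thesis using cone_ball_local_cone[OF P, of s] by blast
  qed
  then show ?thesis unfolding n_pre_stable_def Delta_nonneg_def by simp
qed

text \<open>At k = 1 the empty set is the only odd term and {1} the only even one, so the inequality
  compares f x with f (x + u_1). Such pairs are exactly the comparable pairs in the ball.\<close>

lemma Delta_nonneg_1_iff:
  assumes P: "normed_cone P" and Q: "normed_cone Q" and f: "f \<in> cone_ball P \<rightarrow> carrier Q"
  shows "Delta_nonneg P Q f 1 \<longleftrightarrow> monotone_on (cone_ball P) (cone_le P) (cone_le Q) f"
proof -
  interpret P: normed_cone P by fact
  have D: "Delta_minus P Q f 1 x u = f x" "Delta_plus P Q f 1 x u = f (x \<oplus>\<^bsub>P\<^esub> u 1)"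
      "x \<in> cone_ball P"
    if "u 1 \<in> carrier P" "x \<in> carrier P" "x \<oplus>\<^bsub>P\<^esub> u 1 \<in> cone_ball P" for x u
  proof -
    show x: "x \<in> cone_ball P" using cone_ball_summand[OF P that(2,1,3)] .
    have "f x \<in> carrier Q" "f (x \<oplus>\<^bsub>P\<^esub> u 1) \<in> carrier Q" using f x that by auto
    from Delta_1[where f = f and u = u, OF P Q that(1,2) this]
    show "Delta_minus P Q f 1 x u = f x" "Delta_plus P Q f 1 x u = f (x \<oplus>\<^bsub>P\<^esub> u 1)" .
  qed
  have s: "(\<Oplus>\<^bsub>P\<^esub>i \<in> {1..1::nat}. u i) = u 1" if "u 1 \<in> carrier P" for u using that by simp
  show ?thesis
  proof
    assume L: "Delta_nonneg P Q f 1"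
    show "monotone_on (cone_ball P) (cone_le P) (cone_le Q) f"
    proof (rule monotone_onI)
      fix x y assume "x \<in> cone_ball P" "y \<in> cone_ball P" "cone_le P x y"
      then obtain z where z: "z \<in> carrier P" "x \<in> carrier P" "y = x \<oplus>\<^bsub>P\<^esub> z" "y \<in> cone_ball P"
        by (auto simp: cone_le_def)
      define u where "u = (\<lambda>_::nat. z)"
      have u: "u \<in> {1..1} \<rightarrow> carrier P" "u 1 = z" using z by (auto simp: u_def)
      then have "cone_le Q (Delta_minus P Q f 1 x u) (Delta_plus P Q f 1 x u)"
        using L z s[of u] unfolding Delta_nonneg_def by metis
      then show "cone_le Q (f x) (f y)" using D[of u x] z u by simp
    qed
  next
    assume M: "monotone_on (cone_ball P) (cone_le P) (cone_le Q) f"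
    show "Delta_nonneg P Q f 1" unfolding Delta_nonneg_def
    proof (intro ballI impI)
      fix u :: "nat \<Rightarrow> 'a" and x
      assume u: "u \<in> {1..1} \<rightarrow> carrier P" and x: "x \<in> carrier P"
        and b: "x \<oplus>\<^bsub>P\<^esub> (\<Oplus>\<^bsub>P\<^esub>i \<in> {1..1}. u i) \<in> cone_ball P"
      have u1: "u 1 \<in> carrier P" using u by simp
      have b': "x \<oplus>\<^bsub>P\<^esub> u 1 \<in> cone_ball P" using b s[of u, OF u1] by metis
      note D' = D[of u, OF u1 x b']
      have "cone_le P x (x \<oplus>\<^bsub>P\<^esub> u 1)" using x u1 by (auto simp: cone_le_def)
      then have "cone_le Q (f x) (f (x \<oplus>\<^bsub>P\<^esub> u 1))"
        using monotone_onD[OF M D'(3) b'] by simp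
      then show "cone_le Q (Delta_minus P Q f 1 x u) (Delta_plus P Q f 1 x u)"
        by (simp only: D')
    qed
  qed
qed

text \<open>The last entry of a sequence of length k+1 plays the role of the point v at which the
  local cone is taken. Beyond \<open>Delta_le_Suc_iff\<close>, what remains is to match the domain
  conditions in P and in the local cone.\<close>

lemma Delta_nonneg_Suc_iff:
  assumes P: "normed_cone P" and Q: "normed_cone Q" and f: "f \<in> cone_ball P \<rightarrow> carrier Q"
    and mono: "monotone_on (cone_ball P) (cone_le P) (cone_le Q) f"
  shows "Delta_nonneg P Q f (Suc k) \<longleftrightarrow>
    (\<forall>v \<in> cone_ball P. Delta_nonneg (local_cone P v) Q (\<lambda>y. cone_diff Q (f (y \<oplus>\<^bsub>P\<^esub> v)) (f y)) k)"
    (is "?L \<longleftrightarrow> (\<forall>v \<in> _. Delta_nonneg _ _ (?g v) _)")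
proof -
  interpret P: normed_cone P by fact
  have sum_Suc: "(\<Oplus>\<^bsub>P\<^esub>i \<in> {1..Suc k}. u i) = (\<Oplus>\<^bsub>P\<^esub>i \<in> {1..k}. u i) \<oplus>\<^bsub>P\<^esub> u (Suc k)"
    if "u \<in> {1..k} \<rightarrow> carrier P" "u (Suc k) \<in> carrier P" for u
    using that by (simp add: atLeastAtMostSuc_conv P.a_comm)
  show ?thesis
  proof (intro iffI ballI)
    fix v assume L: ?L and v: "v \<in> cone_ball P"
    have vc: "v \<in> carrier P" using v by (rule cone_ballD)
    show "Delta_nonneg (local_cone P v) Q (?g v) k"
      unfolding Delta_nonneg_def
    proof (intro ballI impI)
      fix u x
      assume u: "u \<in> {1..k} \<rightarrow> carrier (local_cone P v)" and x: "x \<in> carrier (local_cone P v)"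
        and b: "x \<oplus>\<^bsub>local_cone P v\<^esub> (\<Oplus>\<^bsub>local_cone P v\<^esub>i \<in> {1..k}. u i) \<in> cone_ball (local_cone P v)"
      have uP: "u \<in> {1..k} \<rightarrow> carrier P" and xP: "x \<in> carrier P"
        using u x by (auto simp: carrier_local_cone)
      \<comment> \<open>Appending v as entry k+1 gives a sequence in P to which the hypothesis on f
        at order k+1 applies.\<close>
      define w where "w = u(Suc k := v)"
      have w: "w \<in> {1..k} \<rightarrow> carrier P" "w (Suc k) = v" "w \<in> {1..Suc k} \<rightarrow> carrier P"
          "\<And>i. i \<in> {1..k} \<Longrightarrow> u i = w i"
        using uP vc by (auto simp: w_def)
      have wu: "(\<Oplus>\<^bsub>P\<^esub>i \<in> {1..k}. w i) = (\<Oplus>\<^bsub>P\<^esub>i \<in> {1..k}. u i)"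
        using uP w(4) by (intro P.finsum_cong') auto
      have "x \<oplus>\<^bsub>P\<^esub> (\<Oplus>\<^bsub>P\<^esub>i \<in> {1..k}. u i) \<oplus>\<^bsub>P\<^esub> v \<in> cone_ball P"
        using b cone_ball_local_cone[OF P v] finsum_local_cone[OF P v _ u] by simp
      then have ball: "x \<oplus>\<^bsub>P\<^esub> (\<Oplus>\<^bsub>P\<^esub>i \<in> {1..Suc k}. w i) \<in> cone_ball P"
        using sum_Suc[OF w(1)] w(2) wu vc uP xP by (simp add: P.a_assoc)
      show "cone_le Q (Delta_minus (local_cone P v) Q (?g v) k x u)
          (Delta_plus (local_cone P v) Q (?g v) k x u)"
        using L w(3) xP ball Delta_le_Suc_iff[OF P Q f mono w(1) vc w(2) xP ball w(4)]
        unfolding Delta_nonneg_def by blast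
    qed
  next
    assume R: "\<forall>v \<in> cone_ball P. Delta_nonneg (local_cone P v) Q (?g v) k"
    show ?L unfolding Delta_nonneg_def
    proof (intro ballI impI)
      fix u x
      assume u: "u \<in> {1..Suc k} \<rightarrow> carrier P" and x: "x \<in> carrier P"
        and b: "x \<oplus>\<^bsub>P\<^esub> (\<Oplus>\<^bsub>P\<^esub>i \<in> {1..Suc k}. u i) \<in> cone_ball P"
      define v where "v = u (Suc k)"
      have u': "u \<in> {1..k} \<rightarrow> carrier P" and vc: "v \<in> carrier P" using u by (auto simp: v_def)
      have sP: "(\<Oplus>\<^bsub>P\<^esub>i \<in> {1..k}. u i) \<in> carrier P" using u' by simp
      have b': "x \<oplus>\<^bsub>P\<^esub> (\<Oplus>\<^bsub>P\<^esub>i \<in> {1..k}. u i) \<oplus>\<^bsub>P\<^esub> v \<in> cone_ball P"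
        using b sum_Suc[OF u'] vc x sP by (simp add: v_def P.a_assoc)
      have vb: "v \<in> cone_ball P"
        using b' cone_ball_summand[OF P vc, of "x \<oplus>\<^bsub>P\<^esub> (\<Oplus>\<^bsub>P\<^esub>i \<in> {1..k}. u i)"] vc x sP
        by (simp add: P.a_comm)
      interpret L: normed_cone "local_cone P v" by (rule normed_cone_local_cone[OF P vb])
      have sL: "x \<oplus>\<^bsub>P\<^esub> (\<Oplus>\<^bsub>P\<^esub>i \<in> {1..k}. u i) \<in> cone_ball (local_cone P v)"
        using b' x sP cone_ball_local_cone[OF P vb] by simp
      \<comment> \<open>Here y and z are only assumed to lie in P, and membership of y in the local
        carrier is the conclusion: y + z + v is in the ball, hence so is y + v. Both x and the
        entries u_i enter the local cone this way.\<close>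
      have summand_L: "y \<in> carrier (local_cone P v)"
        if "y \<in> carrier P" "z \<in> carrier P" "y \<oplus>\<^bsub>P\<^esub> z \<in> cone_ball (local_cone P v)" for y z
        using that cone_ball_local_cone[OF P vb] vc cone_ball_summand[OF P, of "y \<oplus>\<^bsub>P\<^esub> v" z]
          cone_ballD[of y "local_cone P v"] by (simp add: P.a_ac)
      have uL: "u i \<in> carrier (local_cone P v)" if i: "i \<in> {1..k}" for i
      proof -
        have "(\<Oplus>\<^bsub>P\<^esub>j \<in> insert i ({1..k} - {i}). u j) = u i \<oplus>\<^bsub>P\<^esub> (\<Oplus>\<^bsub>P\<^esub>j \<in> {1..k} - {i}. u j)"
          using u' i by (intro P.finsum_insert) auto
        moreover have "insert i ({1..k} - {i}) = {1..k}" using i by auto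
        moreover have c: "u i \<in> carrier P" "(\<Oplus>\<^bsub>P\<^esub>j \<in> {1..k} - {i}. u j) \<in> carrier P"
          using u' i by (auto intro!: P.finsum_closed)
        ultimately show ?thesis
          using summand_L[of "u i" "x \<oplus>\<^bsub>P\<^esub> (\<Oplus>\<^bsub>P\<^esub>j \<in> {1..k} - {i}. u j)"] sL x
          by (simp add: P.a_lcomm)
      qed
      have "Delta_nonneg (local_cone P v) Q (?g v) k" using R vb by blast
      moreover have "x \<in> carrier (local_cone P v)" using summand_L[OF x sP sL] .
      moreover have "x \<oplus>\<^bsub>local_cone P v\<^esub> (\<Oplus>\<^bsub>local_cone P v\<^esub>i \<in> {1..k}. u i)
          \<in> cone_ball (local_cone P v)"
        using sL uL finsum_local_cone[OF P vb, of "{1..k}" u] by simp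
      ultimately have "cone_le Q (Delta_minus (local_cone P v) Q (?g v) k x u)
          (Delta_plus (local_cone P v) Q (?g v) k x u)"
        using uL unfolding Delta_nonneg_def by blast
      then show "cone_le Q (Delta_minus P Q f (Suc k) x u) (Delta_plus P Q f (Suc k) x u)"
        using Delta_le_Suc_iff[OF P Q f mono u' vc v_def[symmetric] x b refl] by simp
    qed
  qed
qed

lemma n_non_decreasing_iff_n_pre_stable:
  assumes "normed_cone P" "normed_cone Q" "f \<in> cone_ball P \<rightarrow> carrier Q"
  shows "n_non_decreasing n P Q f \<longleftrightarrow> n_pre_stable n P Q f"
  using assms
\<comment> \<open>The step applies the hypothesis to the local cone at v and to the difference
  function, so both P and f must vary. The target Q stays fixed.\<close>
proof (induction n arbitrary: P f)
  case 0
  then show ?case by (simp add: n_pre_stable_iff_Delta_nonneg Delta_nonneg_1_iff[unfolded One_nat_def])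
next
  case (Suc n)
  note P = Suc.prems(1) and Q = Suc.prems(2) and f = Suc.prems(3)
  let ?M = "monotone_on (cone_ball P) (cone_le P) (cone_le Q) f"
  let ?g = "\<lambda>v y. cone_diff Q (f (y \<oplus>\<^bsub>P\<^esub> v)) (f y)"
  \<comment> \<open>Order 1 is split off because it is monotonicity itself. The orders 2 to n+2 are
    reindexed as successors of 1 to n+1, the range of n-pre-stability for the difference
    function.\<close>
  have split: "(\<forall>k \<in> {1..Suc n + 1}. R k) \<longleftrightarrow> R 1 \<and> (\<forall>k \<in> {1..n + 1}. R (Suc k))" for R
    by (auto simp: Ball_def) (metis Suc_le_D Suc_le_mono le_zero_eq not_less_eq_eq One_nat_def)
  have IH: "n_non_decreasing n (local_cone P v) Q (?g v)
      \<longleftrightarrow> (\<forall>k \<in> {1..n + 1}. Delta_nonneg (local_cone P v) Q (?g v) k)"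
    if M: ?M and v: "v \<in> cone_ball P" for v
  proof -
    interpret P: normed_cone P by fact
    note L = normed_cone_local_cone[OF P v]
    \<comment> \<open>Monotonicity of f makes the differences exist in Q, so the induction
      hypothesis applies only under \<open>?M\<close>. This is why the final equivalences keep
      \<open>?M\<close> as a conjunct.\<close>
    have "?g v \<in> cone_ball (local_cone P v) \<rightarrow> carrier Q"
    proof
      fix y assume "y \<in> cone_ball (local_cone P v)"
      then have y: "y \<in> carrier P" "y \<oplus>\<^bsub>P\<^esub> v \<in> cone_ball P"
        by (auto simp: cone_ball_local_cone[OF P v])
      have "cone_le Q (f y) (f (y \<oplus>\<^bsub>P\<^esub> v))"
        using y cone_ballD[OF v] cone_ball_summand[OF P y(1) cone_ballD[OF v] y(2)]
        by (intro monotone_onD[OF M]) (auto simp: cone_le_def)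
      then show "?g v y \<in> carrier Q" by (rule add_cone_diff(1)[OF Q])
    qed
    then show ?thesis using Suc.IH[OF L Q] n_pre_stable_iff_Delta_nonneg[OF L] by simp
  qed
  have "n_pre_stable (Suc n) P Q f \<longleftrightarrow> ?M \<and> (\<forall>k \<in> {1..n + 1}. Delta_nonneg P Q f (Suc k))"
    unfolding n_pre_stable_iff_Delta_nonneg[OF P] split Delta_nonneg_1_iff[OF P Q f] ..
  also have "\<dots> \<longleftrightarrow> ?M \<and> (\<forall>v \<in> cone_ball P. n_non_decreasing n (local_cone P v) Q (?g v))"
    using Delta_nonneg_Suc_iff[OF P Q f] IH by blast
  finally show ?case by simp
qed

theorem theorem4p18:
  fixes P :: "'a normed_cone" and Q :: "'b normed_cone" and f :: "'a \<Rightarrow> 'b"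
  assumes "normed_cone P" and "normed_cone Q"
    and "f \<in> cone_ball P \<rightarrow> carrier Q"
  shows "(\<forall>n. n_non_decreasing n P Q f \<longleftrightarrow> n_pre_stable n P Q f) \<and>
         (absolutely_monotonic P Q f \<longleftrightarrow> pre_stable P Q f)"
  using n_non_decreasing_iff_n_pre_stable[OF assms]
  by (simp add: absolutely_monotonic_def pre_stable_def)

end
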